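(* \textsc{1-Edge Contraction($\gamma_t$)} is polynomial-time solvable on $P_5$-free graphs.
   Context: All graphs are finite, simple and connected. $P_5$ is the path on 5 vertices; a graph is $P_5$-free if it has no induced subgraph isomorphic to $P_5$. A set $D\subseteq V(G)$ is a total dominating set of $G$ if every vertex of $V(G)$ has at least one neighbor in $D$; $\gamma_t(G)$ is the minimum size of a total dominating set. $G/e$ denotes the graph obtained from $G$ by contracting edge $e$ (merging its endpoints into one vertex adjacent to all former neighbors of either endpoint, without loops or multiple edges). \textsc{1-Edge Contraction($\gamma_t$)}: given a connected graph $G$, decide whether there exists an edge $e$ with $\gamma_t(G/e)\leq\gamma_t(G)-1$. *)

theory Defs
  imports
    "HOL-Library.Extended_Nat"
    "HOL-Computational_Algebra.Polynomial"
begin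

record 'a graph =
  verts :: "'a set"
  edges :: "'a set set"

definition simple_graph :: "'a graph \<Rightarrow> bool" where
  "simple_graph G \<longleftrightarrow> finite (verts G) \<and> (\<forall>e\<in>edges G. e \<subseteq> verts G \<and> card e = 2)"

definition adjacency :: "'a graph \<Rightarrow> ('a \<times> 'a) set" where
  "adjacency G = {(u, v). {u, v} \<in> edges G}"

definition connected_graph :: "'a graph \<Rightarrow> bool" where
  "connected_graph G \<longleftrightarrow>
     verts G \<noteq> {} \<and> (\<forall>u\<in>verts G. \<forall>v\<in>verts G. (u, v) \<in> (adjacency G)\<^sup>*)"

definition induced_subgraph :: "'a graph \<Rightarrow> 'a set \<Rightarrow> 'a graph" where
  "induced_subgraph G S = \<lparr>verts = S, edges = {e \<in> edges G. e \<subseteq> S}\<rparr>"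

definition isomorphic_graphs :: "'a graph \<Rightarrow> 'b graph \<Rightarrow> bool" where
  "isomorphic_graphs G H \<longleftrightarrow>
     (\<exists>f. bij_betw f (verts G) (verts H) \<and>
          (\<forall>u\<in>verts G. \<forall>v\<in>verts G. {u, v} \<in> edges G \<longleftrightarrow> {f u, f v} \<in> edges H))"

definition induced_free :: "'b graph \<Rightarrow> 'a graph \<Rightarrow> bool" where
  "induced_free H G \<longleftrightarrow> \<not> (\<exists>S\<subseteq>verts G. isomorphic_graphs (induced_subgraph G S) H)"

definition path_graph :: "nat \<Rightarrow> nat graph" where
  "path_graph n = \<lparr>verts = {..<n}, edges = {{i, Suc i} | i. Suc i < n}\<rparr>"

text \<open>
  Contraction of an edge \<open>e\<close> as a quotient: the vertices of the contracted graph are the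
  classes of the partition of the vertex set whose only non-singleton class is \<open>e\<close>.
  An edge other than \<open>e\<close> meets \<open>e\<close> in at most one vertex, so its image has two elements;
  removing \<open>e\<close> avoids a loop, and parallel edges coincide as sets.
\<close>

definition contract_vertex :: "'a set \<Rightarrow> 'a \<Rightarrow> 'a set" where
  "contract_vertex e v = (if v \<in> e then e else {v})"

definition contract :: "'a graph \<Rightarrow> 'a set \<Rightarrow> 'a set graph" where
  "contract G e =
     \<lparr>verts = contract_vertex e ` verts G,
      edges = (\<lambda>d. contract_vertex e ` d) ` (edges G - {e})\<rparr>"

definition total_dominating :: "'a graph \<Rightarrow> 'a set \<Rightarrow> bool" where
  "total_dominating G D \<longleftrightarrow> D \<subseteq> verts G \<and> (\<forall>v\<in>verts G. \<exists>d\<in>D. {v, d} \<in> edges G)"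

text \<open>
  A graph with an isolated vertex has no total dominating set; the infimum is then \<open>\<infinity>\<close>.
  Among connected graphs this concerns only the one-vertex graph, which has no edge to
  contract but is itself the contraction of the single edge of the two-vertex graph.
\<close>

definition total_domination_number :: "'a graph \<Rightarrow> enat" (\<open>\<gamma>\<^sub>t\<close>) where
  "\<gamma>\<^sub>t G = (INF D\<in>{D. total_dominating G D}. enat (card D))"

definition one_edge_contraction :: "'a graph \<Rightarrow> bool" where
  "one_edge_contraction G \<longleftrightarrow> (\<exists>e\<in>edges G. \<gamma>\<^sub>t (contract G e) \<le> \<gamma>\<^sub>t G - 1)"

datatype dir = Left | Stay | Right

text \<open>
  States are the numbers below \<open>states\<close>, tape symbols the numbers below \<open>symbols\<close>, and \<open>0\<close> is
  the blank. The transition function takes the current state and the scanned symbols, one per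
  tape, and yields the next state together with a symbol to write and a head movement for each
  tape. By \<open>tm\<close> below only its values on a finite domain matter.
\<close>

record machine =
  tapes :: nat
  states :: nat
  symbols :: nat
  start :: nat
  accept :: nat
  reject :: nat
  delta :: "nat \<Rightarrow> nat list \<Rightarrow> nat \<times> (nat \<times> dir) list"

definition tm :: "machine \<Rightarrow> bool" where
  "tm M \<longleftrightarrow>
     0 < tapes M \<and> 0 < symbols M \<and>
     start M < states M \<and> accept M < states M \<and> reject M < states M \<and>
     accept M \<noteq> reject M \<and>
     (\<forall>q < states M. \<forall>ss. length ss = tapes M \<and> set ss \<subseteq> {..<symbols M} \<longrightarrow>
        (case delta M q ss of (q', acts) \<Rightarrow>
           q' < states M \<and> length acts = tapes M \<and> fst ` set acts \<subseteq> {..<symbols M}))"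

text \<open>A tape is infinite in both directions and is paired with the position of its head.\<close>

type_synonym tape = "(int \<Rightarrow> nat) \<times> int"
type_synonym config = "nat \<times> tape list"

fun scan :: "tape \<Rightarrow> nat" where
  "scan (f, h) = f h"

fun offset :: "dir \<Rightarrow> int" where
  "offset Left = -1"
| "offset Stay = 0"
| "offset Right = 1"

fun act :: "tape \<Rightarrow> nat \<times> dir \<Rightarrow> tape" where
  "act (f, h) (a, d) = (f(h := a), h + offset d)"

text \<open>Configurations in the accepting or rejecting state are halted and do not change.\<close>

fun step :: "machine \<Rightarrow> config \<Rightarrow> config" where
  "step M (q, ts) =
     (if q = accept M \<or> q = reject M then (q, ts)
      else case delta M q (map scan ts) of (q', acts) \<Rightarrow> (q', map2 act ts acts))"

definition input_tape :: "nat list \<Rightarrow> tape" where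
  "input_tape w = ((\<lambda>i. if 0 \<le> i \<and> i < int (length w) then w ! nat i else 0), 0)"

definition blank_tape :: tape where
  "blank_tape = ((\<lambda>_. 0), 0)"

definition initial :: "machine \<Rightarrow> nat list \<Rightarrow> config" where
  "initial M w = (start M, input_tape w # replicate (tapes M - 1) blank_tape)"

definition accepts_within :: "machine \<Rightarrow> nat list \<Rightarrow> nat \<Rightarrow> bool" where
  "accepts_within M w t \<longleftrightarrow> fst ((step M ^^ t) (initial M w)) = accept M"

definition rejects_within :: "machine \<Rightarrow> nat list \<Rightarrow> nat \<Rightarrow> bool" where
  "rejects_within M w t \<longleftrightarrow> fst ((step M ^^ t) (initial M w)) = reject M"

text \<open>
  The decision problem \<open>Y\<close>, restricted to the instances in \<open>I\<close> (encoded as strings by \<open>enc\<close>),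
  is solved by a deterministic machine in time polynomial in the length of the encoding.
  Nothing is required of the machine on strings that do not encode an instance in \<open>I\<close>.
\<close>

definition polynomial_time_solvable_on ::
    "('i \<Rightarrow> nat list) \<Rightarrow> 'i set \<Rightarrow> ('i \<Rightarrow> bool) \<Rightarrow> bool" where
  "polynomial_time_solvable_on enc I Y \<longleftrightarrow>
     (\<exists>M (p :: nat poly). tm M \<and>
        (\<forall>x\<in>I. set (enc x) \<subseteq> {1..<symbols M} \<and>
           (if Y x then accepts_within M (enc x) (poly p (length (enc x)))
            else rejects_within M (enc x) (poly p (length (enc x))))))"

text \<open>
  Input graphs have vertex set \<open>{0, \<dots>, n - 1}\<close> and are given by their adjacency matrix,
  row by row: symbol \<open>1\<close> is the bit zero, \<open>2\<close> the bit one, and \<open>3\<close> ends a row.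
\<close>

definition encode_graph :: "nat graph \<Rightarrow> nat list" where
  "encode_graph G =
     (let n = card (verts G) in
      concat (map (\<lambda>i. map (\<lambda>j. if {i, j} \<in> edges G then 2 else 1) [0..<n] @ [3]) [0..<n]))"

definition input_graphs :: "nat graph set" where
  "input_graphs =
     {G. simple_graph G \<and> connected_graph G \<and> verts G = {..<card (verts G)}}"

end

theory Submission
  imports Defs
begin

text \<open>On a connected \<open>P\<^sub>5\<close>-free graph with at least two vertices the answer is yes iff
  \<open>\<gamma>\<^sub>t \<ge> 3\<close>, i.e. iff no two rows of the adjacency matrix cover all columns (such rows are
  automatically adjacent), which a two-tape machine tests directly.

  Contracting an edge of a path on three vertices inside a minimum total dominating set yields a
  smaller one, while \<open>\<gamma>\<^sub>t\<close> is never below 2. So it suffices that for \<open>\<gamma>\<^sub>t \<ge> 3\<close> some minimum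
  total dominating set contains a (not necessarily induced) path on three vertices. Otherwise a
  minimum set \<open>D\<close> induces a matching with at least two edges. If some vertex sees two of them, or
  if an edge \<open>xy\<close> joins the neighbourhoods of two of them, then exchanging one end of a matching
  edge for \<open>x\<close>, respectively one end of each of two matching edges for \<open>x\<close> and \<open>y\<close>, creates such
  a path and keeps the set total dominating, since any failure exhibits an induced \<open>P\<^sub>5\<close>.\<close>

section \<open>Contractions and total domination in \<open>P\<^sub>5\<close>-free graphs\<close>

definition adj :: "'a graph \<Rightarrow> 'a \<Rightarrow> 'a \<Rightarrow> bool" where
  "adj G u v \<longleftrightarrow> {u, v} \<in> edges G"

lemma adj_sym: "adj G u v \<longleftrightarrow> adj G v u"
  by (simp add: adj_def insert_commute)

lemma adj_verts:
  assumes "simple_graph G" "adj G u v"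
  shows "u \<in> verts G" "v \<in> verts G"
  using assms by (auto simp: simple_graph_def adj_def)

lemma adj_irrefl: "simple_graph G \<Longrightarrow> \<not> adj G v v"
  by (force simp: simple_graph_def adj_def)

lemma total_dominating_adj:
  "total_dominating G D \<longleftrightarrow> D \<subseteq> verts G \<and> (\<forall>v\<in>verts G. \<exists>d\<in>D. adj G v d)"
  by (simp add: total_dominating_def adj_def)

lemma path_graph_5_edges: "edges (path_graph 5) = {{0, 1}, {1, 2}, {2, 3}, {3, 4}}"
proof -
  have "{i. Suc i < 5} = {0, 1, 2, 3}" by auto
  moreover have "edges (path_graph 5) = (\<lambda>i. {i, Suc i}) ` {i. Suc i < 5}"
    by (simp add: path_graph_def setcompr_eq_image)
  ultimately show ?thesis by (simp add: eval_nat_numeral)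
qed

text \<open>The form in which freeness is applied: only adjacencies have to be checked. Distinctness
  of the five vertices follows, since identifying two of them would yield a loop or make one of the
  six excluded pairs adjacent.\<close>

lemma induced_P5_free:
  assumes G: "simple_graph G" and free: "induced_free (path_graph 5) G"
    and e: "adj G a b" "adj G b c" "adj G c d" "adj G d e"
    and n: "\<not> adj G a c" "\<not> adj G a d" "\<not> adj G a e" "\<not> adj G b d" "\<not> adj G b e" "\<not> adj G c e"
  shows False
proof -
  note sym = adj_sym[of G] and irr = adj_irrefl[OF G]
  have ne: "a \<noteq> b" "a \<noteq> c" "a \<noteq> d" "a \<noteq> e" "b \<noteq> c" "b \<noteq> d" "b \<noteq> e" "c \<noteq> d" "c \<noteq> e" "d \<noteq> e"
    using e n irr by (auto simp: sym)
  define S where "S = {a, b, c, d, e}"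
  define f :: "'a \<Rightarrow> nat" where
    "f v = (if v = a then 0 else if v = b then 1 else if v = c then 2 else if v = d then 3 else 4)" for v
  have f: "f a = 0" "f b = 1" "f c = 2" "f d = 3" "f e = 4"
    using ne by (auto simp: f_def)
  have "bij_betw f S {..<5}"
    unfolding bij_betw_def
  proof
    show "inj_on f S" using f by (auto simp: S_def inj_on_def)
    have "{..<5::nat} = {0, 1, 2, 3, 4}" by auto
    then show "f ` S = {..<5}" using f by (simp add: S_def)
  qed
  moreover have "adj G u v \<longleftrightarrow> {f u, f v} \<in> edges (path_graph 5)" if "u \<in> S" "v \<in> S" for u v
    using that e n irr unfolding S_def path_graph_5_edges
    by (elim insertE emptyE; simp add: f doubleton_eq_iff sym)
  ultimately have "isomorphic_graphs (induced_subgraph G S) (path_graph 5)"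
    unfolding isomorphic_graphs_def
    by (intro exI[of _ f]) (auto simp: induced_subgraph_def path_graph_def adj_def)
  moreover have "S \<subseteq> verts G"
    using e adj_verts[OF G] by (auto simp: S_def)
  ultimately show False using free by (auto simp: induced_free_def)
qed

text \<open>In a simple graph where every member of \<open>D\<close> has a neighbour in
  \<open>D\<close>, the absence of such a path means that \<open>D\<close> induces a perfect
  matching.\<close>

definition has_P3 :: "'a graph \<Rightarrow> 'a set \<Rightarrow> bool" where
  "has_P3 G D \<longleftrightarrow> (\<exists>a\<in>D. \<exists>b\<in>D. \<exists>c\<in>D. a \<noteq> c \<and> adj G a b \<and> adj G b c)"

text \<open>Replacing \<open>b\<close> by \<open>x\<close> does not enlarge the set and creates the
  path \<open>a\<close>, \<open>x\<close>, \<open>c\<close>, so by \<open>min\<close> the new set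
  leaves some \<open>w\<close> undominated; \<open>D\<close> dominates \<open>w\<close>, hence
  through \<open>b\<close> alone.\<close>

lemma exchange_private:
  assumes D: "total_dominating G D" and fin: "finite D"
    and min: "\<And>D'. total_dominating G D' \<Longrightarrow> card D' \<le> card D \<Longrightarrow> \<not> has_P3 G D'"
    and mem: "a \<in> D" "b \<in> D" "c \<in> D" "c \<noteq> a" "c \<noteq> b" and irr: "\<not> adj G a a" "\<not> adj G b b"
    and adj: "adj G a b" "adj G x a" "adj G x b" "adj G x c" "x \<in> verts G"
  obtains w where "w \<in> verts G" "adj G w b" "\<not> adj G w x" "\<And>d. d \<in> D \<Longrightarrow> d \<noteq> b \<Longrightarrow> \<not> adj G w d"
proof -
  define D' where "D' = insert x (D - {b})"
  have "card D' \<le> card D"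
    using fin mem card_Suc_Diff1[OF fin \<open>b \<in> D\<close>] card_insert_le_m1[of "card D" "D - {b}" x]
    by (simp add: D'_def card_insert_if split: if_splits)
  moreover have "has_P3 G D'"
  proof -
    have "a \<noteq> b" using adj irr by auto
    then show ?thesis unfolding has_P3_def D'_def
      using mem adj adj_sym[of G x a]
      by (intro bexI[of _ a] bexI[of _ x] bexI[of _ c]) auto
  qed
  ultimately have "\<not> total_dominating G D'" using min by blast
  moreover have "D' \<subseteq> verts G" using D adj by (auto simp: D'_def total_dominating_def)
  ultimately obtain w where w: "w \<in> verts G" "\<forall>d\<in>D'. \<not> adj G w d"
    by (auto simp: total_dominating_adj)
  then have "adj G w b" "\<not> adj G w x" "\<And>d. d \<in> D \<Longrightarrow> d \<noteq> b \<Longrightarrow> \<not> adj G w d"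
    using D by (auto simp: D'_def total_dominating_adj)
  with w(1) show ?thesis by (rule that)
qed

text \<open>Minimality enters through the contradiction hypothesis: no total dominating set of at
  most this size contains a path on three vertices. An exchange that creates such a path must
  therefore leave a vertex undominated, and this vertex lies on an induced path on five
  vertices.\<close>

lemma minimum_total_dominating_P3:
  assumes G: "simple_graph G" and con: "connected_graph G" and free: "induced_free (path_graph 5) G"
    and D: "total_dominating G D" and card: "card D \<ge> 3"
  shows "\<exists>D'. total_dominating G D' \<and> card D' \<le> card D \<and> has_P3 G D'"
proof (rule ccontr)
  assume "\<not> ?thesis"
  then have min: "\<not> has_P3 G D'" if "total_dominating G D'" "card D' \<le> card D" for D'
    using that by blast
  note sym = adj_sym[of G]
  note irr = adj_irrefl[OF G]
  note P5 = induced_P5_free[OF G free]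
  have sub: "D \<subseteq> verts G" and dom: "\<And>v. v \<in> verts G \<Longrightarrow> \<exists>d\<in>D. adj G v d"
    using D by (auto simp: total_dominating_adj)
  have fin: "finite D" using card by (metis card.infinite not_numeral_le_zero)
  \<comment> \<open>So \<open>D\<close> induces a matching: members with a common neighbour in
    \<open>D\<close> coincide, and \<open>partner\<close> supplies the other end of each
    edge.\<close>
  have mat: "a = c" if "a \<in> D" "b \<in> D" "c \<in> D" "adj G a b" "adj G b c" for a b c
    using min[OF D] that by (auto simp: has_P3_def)
  have partner: "\<exists>b\<in>D. adj G a b" if "a \<in> D" for a using that sub dom by blast
  have priv: thesis
    if "a \<in> D" "b \<in> D" "c \<in> D" "c \<noteq> a" "c \<noteq> b" "adj G a b" "adj G x a" "adj G x b" "adj G x c"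
      "\<And>w. \<lbrakk>adj G w b; \<not> adj G w x; \<And>d. d \<in> D \<Longrightarrow> d \<noteq> b \<Longrightarrow> \<not> adj G w d\<rbrakk> \<Longrightarrow> thesis"
    for a b c x thesis
    using exchange_private[OF D fin min, of a b c x thesis] that irr adj_verts(1)[OF G that(7)] by blast
  text \<open>If \<open>x\<close> sees both ends of a matching edge and an end of another one, then no end can be
    exchanged for \<open>x\<close>, and private neighbours \<open>w\<close>, \<open>z\<close> of ends of different edges complete an
    induced \<open>P\<^sub>5\<close>.\<close>
  have complete: False
    if m: "a \<in> D" "b \<in> D" "c \<in> D" "d \<in> D" and e: "adj G a b" "adj G c d" "\<not> adj G a c"
      and x: "adj G x a" "adj G x b" "adj G x c" and ac: "a \<noteq> c" for a b c d x
  proof -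
    have ne: "a \<noteq> b" "a \<noteq> d" "b \<noteq> c" "b \<noteq> d" "c \<noteq> d"
      using e m mat[of a b c] irr ac by (auto simp: sym)
    have na: "\<not> adj G a d" "\<not> adj G b c" "\<not> adj G b d"
      using e m mat[of a d c] mat[of a b c] mat[of a b d] ne ac by (auto simp: sym)
    obtain w where w0: "adj G w b" "\<not> adj G w x" "\<And>d. d \<in> D \<Longrightarrow> d \<noteq> b \<Longrightarrow> \<not> adj G w d"
      using priv[of a b c x] m e(1) x ac ne(3) by blast
    then have w: "adj G w b" "\<not> adj G w x" "\<not> adj G w a" "\<not> adj G w c" "\<not> adj G w d"
      using m ne by auto
    have xd: "adj G x d"
    proof (rule ccontr)
      assume "\<not> adj G x d"
      then show False
        by (intro P5[of w b x c d]) (use w e x na in \<open>simp_all add: sym\<close>)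
    qed
    obtain z where z0: "adj G z d" "\<not> adj G z x" "\<And>u. u \<in> D \<Longrightarrow> u \<noteq> d \<Longrightarrow> \<not> adj G z u"
      using priv[of c d a x] m e(2) x xd ac ne(2) by blast
    then have z: "adj G z d" "\<not> adj G z x" "\<not> adj G z a" "\<not> adj G z b" "\<not> adj G z c"
      using m ne by auto
    show False
    proof (cases "adj G w z")
      case True
      then show False 
        by (intro P5[of a b w z d]) (use w z e na in \<open>simp_all add: sym\<close>)
    next
      case False
      then show False 
        by (intro P5[of w b x d z]) (use w z e x xd na in \<open>simp_all add: sym\<close>)
    qed
  qed
  \<comment> \<open>The neighbours of \<open>x\<close> in \<open>D\<close> lie in one matching edge:
    otherwise \<open>b\<close>, \<open>a\<close>, \<open>x\<close>, \<open>c\<close>,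
    \<open>d\<close> is an induced path, or \<open>x\<close> also sees \<open>b\<close> or
    \<open>d\<close> and \<open>complete\<close> applies.\<close>
  have two: "a = c \<or> adj G a c" if m: "a \<in> D" "c \<in> D" and x: "adj G x a" "adj G x c" for a c x
  proof (rule ccontr)
    assume n: "\<not> ?thesis"
    obtain b d where bd: "b \<in> D" "d \<in> D" "adj G a b" "adj G c d"
      using partner m by blast
    have ne: "a \<noteq> d" "b \<noteq> c" "b \<noteq> d" and na: "\<not> adj G a d" "\<not> adj G b c" "\<not> adj G b d"
      using bd m n mat[of a d c] mat[of c d a] mat[of a b c] mat[of a b d]
      by (auto simp: sym)
    consider "adj G x b" | "adj G x d" | "\<not> adj G x b" "\<not> adj G x d" by blast
    then show False
    proof cases
      case 1
      then show False using complete[of a b c d x] m bd n x by blast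
    next
      case 2
      then show False using complete[of c d a b x] m bd n x sym[of a c] by blast
    next
      case 3
      then show False 
        by (intro P5[of b a x c d]) (use bd n x na in \<open>simp_all add: sym\<close>)
    qed
  qed
  obtain a b where ab: "a \<in> D" "b \<in> D" "adj G a b"
  proof -
    have "D \<noteq> {}" using card by auto
    then show ?thesis using partner that by blast
  qed
  obtain c where c: "c \<in> D" "c \<noteq> a" "c \<noteq> b"
  proof -
    have "\<not> D \<subseteq> {a, b}"
      using card card_mono[of "{a, b}" D] card_insert_le_m1[of 2 "{b}" a] by auto
    then show ?thesis using that by blast
  qed
  \<comment> \<open>The neighbourhood of the edge \<open>ab\<close> contains \<open>a\<close> but
    not \<open>c\<close>, so a walk from \<open>a\<close> to \<open>c\<close> has an edge
    \<open>xy\<close> that leaves it.\<close>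
  define P where "P v \<longleftrightarrow> adj G v a \<or> adj G v b" for v
  have "(a, c) \<in> (adjacency G)\<^sup>*"
    using con ab c sub by (auto simp: connected_graph_def)
  moreover have "P a" "\<not> P c"
    using ab c mat[of a b c] mat[of b a c] by (auto simp: P_def sym)
  ultimately obtain x y where xy: "adj G x y" "P x" "\<not> P y"
  proof (induction arbitrary: thesis rule: rtrancl_induct)
    case base
    then show ?case by blast
  next
    case (step u v)
    then show ?case by (cases "P u") (auto simp: adjacency_def adj_def)
  qed
  have yV: "y \<in> verts G" "x \<in> verts G" using xy adj_verts[OF G] by blast+
  obtain p where p: "p \<in> D" "adj G y p" using dom yV by blast
  obtain q where q: "q \<in> D" "adj G p q" using partner p by blast
  have ya: "\<not> adj G y a" "\<not> adj G y b" using xy by (auto simp: P_def)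
  have pne: "p \<noteq> a" "p \<noteq> b" "q \<noteq> a" "q \<noteq> b" "a \<noteq> b" "p \<noteq> q"
    and pna: "\<not> adj G p a" "\<not> adj G p b" "\<not> adj G q a" "\<not> adj G q b"
    using p q ya ab mat sym irr by metis+
  \<comment> \<open>By \<open>two\<close>, \<open>x\<close> sees no end of \<open>pq\<close>. Then
    \<open>x\<close> sees both ends of \<open>ab\<close>, and \<open>y\<close> both ends of
    \<open>pq\<close>, since a missed end would begin an induced path running through
    \<open>x\<close> and \<open>y\<close>.\<close>
  have xp: "\<not> adj G x p" "\<not> adj G x q"
    using xy(2) two[of _ p x] two[of _ q x] p q ab pne pna sym unfolding P_def by metis+
  have xab: "adj G x a" "adj G x b"
    using xy P5[of b a x y p] P5[of a b x y p] p ab ya xp pna sym unfolding P_def by metis+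
  have yq: "adj G y q"
    using P5[of q p y x a] p q xy(1) xab ya xp pna sym by metis
  \<comment> \<open>Now \<open>a\<close>, \<open>x\<close>, \<open>y\<close> is a path in
    \<open>D'\<close>. A vertex \<open>w\<close> without neighbour in \<open>D'\<close> sees only
    \<open>b\<close> or \<open>q\<close> in \<open>D\<close>, which makes \<open>w\<close>,
    \<open>b\<close>, \<open>x\<close>, \<open>y\<close>, \<open>p\<close> or \<open>w\<close>,
    \<open>q\<close>, \<open>y\<close>, \<open>x\<close>, \<open>a\<close> an induced path.\<close>
  define D' where "D' = insert x (insert y (D - {b, q}))"
  have xD: "x \<notin> D" and yD: "y \<notin> D"
    using xab yq p q ab mat pne sym by metis+
  have "card D' = card D"
  proof -
    have "card (D - {b, q}) = card D - 2"
      using ab q pne fin by (subst card_Diff_subset) auto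
    moreover have "x \<noteq> y" using xy by (auto simp: P_def)
    ultimately show ?thesis using card xD yD fin by (simp add: D'_def)
  qed
  moreover have "has_P3 G D'"
    unfolding has_P3_def D'_def
    using ab p q pne xab xy(1,2,3) sym[of x a]
    by (intro bexI[of _ a] bexI[of _ x] bexI[of _ y]) (auto simp: xD yD)
  moreover have "total_dominating G D'"
    unfolding total_dominating_adj
  proof (intro conjI ballI)
    show "D' \<subseteq> verts G" using sub yV by (auto simp: D'_def)
  next
    fix w assume w: "w \<in> verts G"
    show "\<exists>d\<in>D'. adj G w d"
    proof (rule ccontr)
      assume n: "\<not> ?thesis"
      then have wn: "\<not> adj G w x" "\<not> adj G w y" "\<And>d. d \<in> D \<Longrightarrow> d \<noteq> b \<Longrightarrow> d \<noteq> q \<Longrightarrow> \<not> adj G w d"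
        by (auto simp: D'_def)
      then have "\<not> adj G w a" "\<not> adj G w p" using ab p pne by auto
      moreover obtain d where d: "d \<in> D" "adj G w d" using dom w by blast
      ultimately consider "adj G w b" | "adj G w q" using wn by blast
      then show False
      proof cases
        case 1
        then show False
          by (intro P5[of w b x y p])
            (use wn(1,2) p xy(1) xab ya xp pna \<open>\<not> adj G w p\<close> in \<open>simp_all add: sym\<close>)
      next
        case 2
        then show False
          by (intro P5[of w q y x a])
            (use wn(1,2) yq xy(1) xab ya xp pna \<open>\<not> adj G w a\<close> in \<open>simp_all add: sym\<close>)
      qed
    qed
  qed
  ultimately show False using min by simp
qed

section \<open>Total domination numbers under contraction\<close>

lemma total_domination_number_le: "total_dominating G D \<Longrightarrow> \<gamma>\<^sub>t G \<le> enat (card D)"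
  unfolding total_domination_number_def by (intro INF_lower) simp

text \<open>\<open>enat\<close> is well-ordered, so the infimum of a nonempty family is one of its
  members.\<close>

lemma total_domination_number_attained:
  assumes "total_dominating G D"
  obtains D0 where "total_dominating G D0" "\<gamma>\<^sub>t G = enat (card D0)"
proof -
  have "(\<lambda>D. enat (card D)) ` {D. total_dominating G D} \<noteq> {}" using assms by auto
  then have "\<gamma>\<^sub>t G \<in> (\<lambda>D. enat (card D)) ` {D. total_dominating G D}"
    unfolding total_domination_number_def by (rule wellorder_InfI[OF ex_in_conv[THEN iffD2, THEN someI_ex]])
  then show ?thesis using that by auto
qed

lemma total_domination_number_ge_2:
  assumes G: "simple_graph G" and ne: "verts G \<noteq> {}"
  shows "2 \<le> \<gamma>\<^sub>t G"
  unfolding total_domination_number_def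
proof (rule INF_greatest)
  fix D assume "D \<in> {D. total_dominating G D}"
  then have D: "D \<subseteq> verts G" "\<And>v. v \<in> verts G \<Longrightarrow> \<exists>d\<in>D. adj G v d"
    by (auto simp: total_dominating_adj)
  obtain a where a: "a \<in> D" using D(2) ne by blast
  then obtain b where b: "b \<in> D" "adj G a b" using D by blast
  have "a \<noteq> b" using b adj_irrefl[OF G] by blast
  moreover have "finite D" using G D(1) finite_subset by (auto simp: simple_graph_def)
  ultimately have "2 \<le> card D" using a b card_mono[of D "{a, b}"] by simp
  then show "2 \<le> enat (card D)" by (simp flip: enat_numeral)
qed

text \<open>An edge other than \<open>e\<close> cannot lie inside \<open>e\<close>, as both have two
  vertices, so its ends fall into different classes. This makes the lower bound 2 available for
  contracted graphs.\<close>

lemma simple_contract: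
  assumes G: "simple_graph G" and e: "e \<in> edges G"
  shows "simple_graph (contract G e)"
proof -
  have e2: "card e = 2" using G e by (auto simp: simple_graph_def)
  have "contract_vertex e ` d \<subseteq> contract_vertex e ` verts G \<and> card (contract_vertex e ` d) = 2"
    if d: "d \<in> edges G" "d \<noteq> e" for d
  proof -
    have d2: "card d = 2" and dV: "d \<subseteq> verts G" using G d by (auto simp: simple_graph_def)
    obtain u v where uv: "d = {u, v}" "u \<noteq> v" using d2 by (auto simp: card_2_iff)
    have "\<not> (u \<in> e \<and> v \<in> e)"
      using d uv d2 e2 card_subset_eq[of e d] card.infinite[of e] by auto
    then have "contract_vertex e u \<noteq> contract_vertex e v"
      using uv(2) by (auto simp: contract_vertex_def)
    then show ?thesis using uv(1) dV by auto
  qed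
  then show ?thesis using G by (auto simp: simple_graph_def contract_def)
qed

lemma one_edge_contraction_total_domination_number_ne_2:
  assumes G: "simple_graph G" and "one_edge_contraction G"
  shows "\<gamma>\<^sub>t G \<noteq> 2"
proof
  assume 2: "\<gamma>\<^sub>t G = 2"
  obtain e where e: "e \<in> edges G" "\<gamma>\<^sub>t (contract G e) \<le> \<gamma>\<^sub>t G - 1"
    using assms by (auto simp: one_edge_contraction_def)
  have "e \<noteq> {}" "e \<subseteq> verts G" using G e by (auto simp: simple_graph_def)
  then have "verts (contract G e) \<noteq> {}" by (auto simp: contract_def)
  then have "2 \<le> \<gamma>\<^sub>t (contract G e)" by (intro total_domination_number_ge_2 simple_contract G e)
  with e(2) 2 have "(2::enat) \<le> 2 - 1" by simp
  then show False by (simp add: eval_nat_numeral one_enat_def flip: enat_numeral)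
qed

text \<open>Contracting \<open>ab\<close> identifies two members of \<open>D\<close>, so the image
  of \<open>D\<close> is smaller, while edges other than \<open>ab\<close> dominate as
  before.\<close>

lemma one_edge_contraction_if_P3:
  assumes G: "simple_graph G" and D: "total_dominating G D" and min: "\<gamma>\<^sub>t G = enat (card D)"
    and "has_P3 G D"
  shows "one_edge_contraction G"
proof -
  obtain a b c where abc: "a \<in> D" "b \<in> D" "c \<in> D" "a \<noteq> c" "adj G a b" "adj G b c"
    using assms by (auto simp: has_P3_def)
  have ab: "a \<noteq> b" and bc: "b \<noteq> c" using abc adj_irrefl[OF G] by auto
  have DV: "D \<subseteq> verts G" and fin: "finite D"
    using D G finite_subset by (auto simp: total_dominating_def simple_graph_def)
  define e where "e = {a, b}"
  define p where "p = contract_vertex e"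
  have e: "e \<in> edges G" using abc by (simp add: e_def adj_def)
  have edge: "{p u, p v} \<in> edges (contract G e)" if "adj G u v" "{u, v} \<noteq> e" for u v
  proof -
    have "(\<lambda>d. p ` d) {u, v} \<in> (\<lambda>d. p ` d) ` (edges G - {e})"
      using that by (intro imageI) (simp add: adj_def)
    then show ?thesis by (simp add: contract_def p_def)
  qed
  have "total_dominating (contract G e) (p ` D)"
    unfolding total_dominating_def
  proof (intro conjI ballI)
    show "p ` D \<subseteq> verts (contract G e)" using DV by (auto simp: contract_def p_def)
  next
    fix v' assume "v' \<in> verts (contract G e)"
    then obtain v where v: "v \<in> verts G" "v' = p v" by (auto simp: contract_def p_def)
    then obtain d where d: "d \<in> D" "adj G v d" using D by (auto simp: total_dominating_adj)
    show "\<exists>d'\<in>p ` D. {v', d'} \<in> edges (contract G e)"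
    proof (cases "{v, d} = e")
      case True
      then have "p v = p b" by (auto simp: p_def contract_vertex_def e_def doubleton_eq_iff)
      \<comment> \<open>Only domination along \<open>ab\<close> is lost; the merged vertex is still
        dominated by \<open>c\<close>, where \<open>a \<noteq> c\<close> ensures that
        \<open>bc\<close> is not the contracted edge.\<close>
      moreover have "{p b, p c} \<in> edges (contract G e)"
        using abc ab bc by (intro edge) (auto simp: e_def doubleton_eq_iff)
      ultimately show ?thesis using v abc by auto
    next
      case False
      then show ?thesis using edge[of v d] d v by auto
    qed
  qed
  then have "\<gamma>\<^sub>t (contract G e) \<le> enat (card (p ` D))" by (rule total_domination_number_le)
  also have "p ` D = p ` (D - {a})"
  proof -
    have "p a = p b" by (auto simp: p_def contract_vertex_def e_def)
    then show ?thesis using abc ab by (auto simp: image_iff)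
  qed
  also have "enat (card (p ` (D - {a}))) \<le> enat (card D - 1)"
    using card_image_le[of "D - {a}" p] fin abc by simp
  also have "\<dots> = \<gamma>\<^sub>t G - 1" by (simp add: min one_enat_def)
  finally show ?thesis using e by (auto simp: one_edge_contraction_def)
qed

lemma connected_total_dominating:
  assumes "simple_graph G" "connected_graph G" "card (verts G) \<ge> 2"
  shows "total_dominating G (verts G)"
  unfolding total_dominating_adj
proof (intro conjI ballI)
  fix v assume v: "v \<in> verts G"
  have "\<not> verts G \<subseteq> {v}" using assms(3) card_mono[of "{v}" "verts G"] by auto
  then obtain u where "u \<in> verts G" "u \<noteq> v" by auto
  then have "(v, u) \<in> (adjacency G)\<^sup>*" "u \<noteq> v"
    using assms(2) v by (auto simp: connected_graph_def)
  then obtain x where "(v, x) \<in> adjacency G" by (auto elim: converse_rtranclE)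
  then have "adj G v x" by (simp add: adjacency_def adj_def)
  then show "\<exists>d\<in>verts G. adj G v d" using adj_verts[OF assms(1)] by blast
qed simp

text \<open>Taking \<open>w = u\<close> shows that \<open>u\<close> and \<open>v\<close> are
  adjacent, so such a pair is a total dominating set of size 2. The one-vertex graph has no such
  pair, yet its answer is no for lack of an edge; hence the separate conjunct.\<close>

lemma one_edge_contraction_P5_free:
  assumes G: "simple_graph G" and con: "connected_graph G" and free: "induced_free (path_graph 5) G"
  shows "one_edge_contraction G \<longleftrightarrow>
    card (verts G) \<noteq> 1 \<and> \<not> (\<exists>u\<in>verts G. \<exists>v\<in>verts G. \<forall>w\<in>verts G. adj G u w \<or> adj G v w)"
    (is "_ \<longleftrightarrow> _ \<and> \<not> ?pair")
proof (intro iffI conjI notI)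
  assume "one_edge_contraction G" and c: "card (verts G) = 1"
  then obtain e where "e \<subseteq> verts G" "card e = 2"
    using G by (auto simp: one_edge_contraction_def simple_graph_def)
  then show False using c card_mono[of "verts G" e] G by (auto simp: simple_graph_def)
next
  assume yes: "one_edge_contraction G" and ?pair
  then obtain u v where uv: "u \<in> verts G" "v \<in> verts G"
    "\<And>w. w \<in> verts G \<Longrightarrow> adj G u w \<or> adj G v w" by blast
  then have "total_dominating G {u, v}"
    using adj_sym[of G] by (auto simp: total_dominating_adj)
  then have "\<gamma>\<^sub>t G \<le> enat (card {u, v})" by (rule total_domination_number_le)
  also have "\<dots> \<le> 2" by (simp add: card_insert_if flip: enat_numeral)
  finally have "\<gamma>\<^sub>t G = 2"
    using total_domination_number_ge_2[OF G] con by (intro order_antisym) (simp_all add: connected_graph_def)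
  then show False using one_edge_contraction_total_domination_number_ne_2[OF G yes] by simp
next
  assume *: "card (verts G) \<noteq> 1 \<and> \<not> ?pair"
  have fin: "finite (verts G)" using G by (simp add: simple_graph_def)
  have "card (verts G) \<noteq> 0" using con fin by (auto simp: connected_graph_def)
  with * have "card (verts G) \<ge> 2" by linarith
  then have "total_dominating G (verts G)" by (rule connected_total_dominating[OF G con])
  then obtain D where D: "total_dominating G D" "\<gamma>\<^sub>t G = enat (card D)" by (rule total_domination_number_attained)
  have DV: "D \<subseteq> verts G" using D(1) by (simp add: total_dominating_def)
  have "card D \<ge> 3"
  proof (rule ccontr)
    assume "\<not> card D \<ge> 3"
    moreover have "2 \<le> card D"
      using total_domination_number_ge_2[OF G] con D by (simp add: connected_graph_def flip: enat_numeral)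
    ultimately have "card D = 2" by linarith
    then obtain u v where "D = {u, v}" by (auto simp: card_2_iff)
    moreover have "adj G u w \<or> adj G v w" if "w \<in> verts G" for w
      using D(1) that \<open>D = {u, v}\<close> adj_sym[of G w u] adj_sym[of G w v]
      by (auto simp: total_dominating_adj)
    ultimately have ?pair using DV by auto
    with * show False by blast
  qed
  then obtain D' where D': "total_dominating G D'" "card D' \<le> card D" "has_P3 G D'"
    using minimum_total_dominating_P3[OF G con free D(1)] by blast
  have "\<gamma>\<^sub>t G = enat (card D')"
    using total_domination_number_le[OF D'(1)] D'(2) D(2) by simp
  then show "one_edge_contraction G"
    using one_edge_contraction_if_P3[OF G D'(1) _ D'(3)] by simp
qed

section \<open>A machine comparing the rows of a matrix\<close>

text \<open>Started with both heads on column \<open>0\<close> of rows \<open>i\<close> and \<open>j\<close>, state \<open>4\<close> compares these rows: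
  it rejects if their disjunction is all ones, and otherwise enters state \<open>5\<close>, which moves the
  second head to row \<open>j + 1\<close> and the first head back, or, after the last row, goes on with
  rows \<open>i + 1\<close> and \<open>0\<close>. States \<open>0\<close> and \<open>1\<close> catch a matrix with one
  row, \<open>2\<close> and \<open>3\<close> copy the input to the second tape and rewind.\<close>

definition row_pair_delta :: "nat \<Rightarrow> nat list \<Rightarrow> nat \<times> (nat \<times> dir) list" where
  "row_pair_delta q ss = (let a = ss ! 0; b = ss ! 1 in
     if q = 0 then (1, [(a, Right), (b, Stay)])
     else if q = 1 then
       if a = 3 then (12, [(a, Stay), (b, Stay)]) else (2, [(a, Left), (b, Stay)])
     else if q = 2 then
       if a = 0 then (3, [(a, Left), (a, Left)]) else (2, [(a, Right), (a, Right)])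
     else if q = 3 then
       if a = 0 then (4, [(a, Right), (b, Right)]) else (3, [(a, Left), (b, Left)])
     else if q = 4 then
       if a = 3 then (12, [(a, Stay), (b, Stay)])
       else if a = 2 \<or> b = 2 then (4, [(a, Right), (b, Right)])
       else (5, [(a, Stay), (b, Stay)])
     else if q = 5 then
       if b = 3 then (6, [(a, Stay), (b, Right)]) else (5, [(a, Stay), (b, Right)])
     else if q = 6 then
       if b = 0 then (8, [(a, Stay), (b, Left)]) else (7, [(a, Stay), (b, Stay)])
     else if q = 7 then
       if a = 0 \<or> a = 3 then (4, [(a, Right), (b, Stay)]) else (7, [(a, Left), (b, Stay)])
     else if q = 8 then
       if a = 3 then (9, [(a, Right), (b, Stay)]) else (8, [(a, Right), (b, Stay)])
     else if q = 9 then
       if a = 0 then (11, [(a, Stay), (b, Stay)]) else (10, [(a, Stay), (b, Stay)])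
     else
       if b = 0 then (4, [(a, Stay), (b, Right)]) else (10, [(a, Stay), (b, Left)]))"

definition row_pair_machine :: machine where
  "row_pair_machine = \<lparr>tapes = 2, states = 13, symbols = 4, start = 0, accept = 11, reject = 12,
     delta = row_pair_delta\<rparr>"

lemma tm_row_pair_machine: "tm row_pair_machine"
proof -
  have "case row_pair_delta q ss of (q', acts) \<Rightarrow>
      q' < 13 \<and> length acts = 2 \<and> fst ` set acts \<subseteq> {..<4}"
    if "length ss = 2" "set ss \<subseteq> {..<4}" for q ss
  proof -
    have "ss ! 0 < 4" "ss ! 1 < 4" using that by (auto dest!: subsetD simp: nth_mem)
    then show ?thesis by (simp add: row_pair_delta_def Let_def)
  qed
  then show ?thesis by (simp add: tm_def row_pair_machine_def)
qed

section \<open>Runs of a machine with time bounds\<close>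

definition reaches :: "machine \<Rightarrow> nat \<Rightarrow> config \<Rightarrow> config \<Rightarrow> bool" where
  "reaches M t c c' \<longleftrightarrow> (\<exists>s\<le>t. (step M ^^ s) c = c')"

lemma reaches_step: "step M c = c' \<Longrightarrow> reaches M 1 c c'"
  unfolding reaches_def by (intro exI[of _ 1]) simp

lemma reaches_trans [trans]:
  assumes "reaches M s c c'" "reaches M t c' c''"
  shows "reaches M (s + t) c c''"
proof -
  obtain s' t' where "s' \<le> s" "t' \<le> t" "(step M ^^ s') c = c'" "(step M ^^ t') c' = c''"
    using assms by (auto simp: reaches_def)
  then show ?thesis
    unfolding reaches_def by (intro exI[of _ "t' + s'"]) (simp add: funpow_add)
qed

lemma reaches_mono: "reaches M s c c' \<Longrightarrow> s \<le> t \<Longrightarrow> reaches M t c c'"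
  unfolding reaches_def using order_trans by blast

lemma reaches_iterate:
  assumes "\<And>i. i < m \<Longrightarrow> reaches M t (c i) (c (Suc i))"
  shows "reaches M (m * t) (c 0) (c m)"
  using assms
proof (induction m)
  case 0
  then show ?case by (auto simp: reaches_def)
next
  case (Suc m)
  then have "reaches M (m * t) (c 0) (c m)" "reaches M t (c m) (c (Suc m))" by auto
  then have "reaches M (m * t + t) (c 0) (c (Suc m))" by (rule reaches_trans)
  then show ?case by (simp add: add.commute)
qed

text \<open>\<open>reaches\<close> bounds the number of steps from above. Halted configurations are
  fixed points, so a run of exactly \<open>t\<close> steps ends in the same configuration, as
  \<open>accepts_within\<close> and \<open>rejects_within\<close> require.\<close>

lemma reaches_halted:
  assumes "reaches M t c (q, ts)" "q = accept M \<or> q = reject M"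
  shows "(step M ^^ t) c = (q, ts)"
proof -
  obtain s where s: "s \<le> t" "(step M ^^ s) c = (q, ts)" using assms(1) by (auto simp: reaches_def)
  have "(step M ^^ k) (q, ts) = (q, ts)" for k
    using assms(2) by (induction k) auto
  then have "(step M ^^ (t - s + s)) c = (q, ts)" using s by (simp only: funpow_add comp_apply)
  then show ?thesis using s by simp
qed

definition conf :: "nat \<Rightarrow> (int \<Rightarrow> nat) \<Rightarrow> int \<Rightarrow> (int \<Rightarrow> nat) \<Rightarrow> int \<Rightarrow> config" where
  "conf q f h g k = (q, [(f, h), (g, k)])"

abbreviation "\<R> \<equiv> reaches row_pair_machine"

text \<open>Handles the transitions that write back the scanned symbols; only copying in state 2
  changes a tape. The bound on \<open>q\<close> excludes the halting states.\<close>

lemma row_pair_step: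
  assumes "row_pair_delta q [f h, g k] = (q', [(f h, d), (g k, e)])" "q < 11"
    "h' = h + offset d" "k' = k + offset e"
  shows "\<R> 1 (conf q f h g k) (conf q' f h' g k')"
  using assms by (intro reaches_step) (simp add: conf_def row_pair_machine_def)

text \<open>One rule per branch of the transition function. At the end of the copying the scanned
  blank is written to the second tape, so \<open>g k = 0\<close> keeps that tape unchanged.\<close>

lemma row_pair_steps:
  shows "\<R> 1 (conf 0 f h g k) (conf 1 f (h + 1) g k)"
    and "f h = 3 \<Longrightarrow> \<R> 1 (conf 1 f h g k) (conf 12 f h g k)"
    and "f h \<noteq> 3 \<Longrightarrow> \<R> 1 (conf 1 f h g k) (conf 2 f (h - 1) g k)"
    and "f h \<noteq> 0 \<Longrightarrow> \<R> 1 (conf 2 f h g k) (conf 2 f (h + 1) (g(k := f h)) (k + 1))"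
    and "f h = 0 \<Longrightarrow> g k = 0 \<Longrightarrow> \<R> 1 (conf 2 f h g k) (conf 3 f (h - 1) g (k - 1))"
    and "f h \<noteq> 0 \<Longrightarrow> \<R> 1 (conf 3 f h g k) (conf 3 f (h - 1) g (k - 1))"
    and "f h = 0 \<Longrightarrow> \<R> 1 (conf 3 f h g k) (conf 4 f (h + 1) g (k + 1))"
    and "f h = 3 \<Longrightarrow> \<R> 1 (conf 4 f h g k) (conf 12 f h g k)"
    and "f h \<noteq> 3 \<Longrightarrow> f h = 2 \<or> g k = 2 \<Longrightarrow> \<R> 1 (conf 4 f h g k) (conf 4 f (h + 1) g (k + 1))"
    and "f h \<noteq> 3 \<Longrightarrow> f h \<noteq> 2 \<Longrightarrow> g k \<noteq> 2 \<Longrightarrow> \<R> 1 (conf 4 f h g k) (conf 5 f h g k)"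
    and "g k = 3 \<Longrightarrow> \<R> 1 (conf 5 f h g k) (conf 6 f h g (k + 1))"
    and "g k \<noteq> 3 \<Longrightarrow> \<R> 1 (conf 5 f h g k) (conf 5 f h g (k + 1))"
    and "g k = 0 \<Longrightarrow> \<R> 1 (conf 6 f h g k) (conf 8 f h g (k - 1))"
    and "g k \<noteq> 0 \<Longrightarrow> \<R> 1 (conf 6 f h g k) (conf 7 f h g k)"
    and "f h = 0 \<or> f h = 3 \<Longrightarrow> \<R> 1 (conf 7 f h g k) (conf 4 f (h + 1) g k)"
    and "f h \<noteq> 0 \<Longrightarrow> f h \<noteq> 3 \<Longrightarrow> \<R> 1 (conf 7 f h g k) (conf 7 f (h - 1) g k)"
    and "f h = 3 \<Longrightarrow> \<R> 1 (conf 8 f h g k) (conf 9 f (h + 1) g k)"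
    and "f h \<noteq> 3 \<Longrightarrow> \<R> 1 (conf 8 f h g k) (conf 8 f (h + 1) g k)"
    and "f h = 0 \<Longrightarrow> \<R> 1 (conf 9 f h g k) (conf 11 f h g k)"
    and "f h \<noteq> 0 \<Longrightarrow> \<R> 1 (conf 9 f h g k) (conf 10 f h g k)"
    and "g k = 0 \<Longrightarrow> \<R> 1 (conf 10 f h g k) (conf 4 f h g (k + 1))"
    and "g k \<noteq> 0 \<Longrightarrow> \<R> 1 (conf 10 f h g k) (conf 10 f h g (k - 1))"
proof -
  show "f h \<noteq> 0 \<Longrightarrow> \<R> 1 (conf 2 f h g k) (conf 2 f (h + 1) (g(k := f h)) (k + 1))"
    by (intro reaches_step) (simp add: conf_def row_pair_machine_def row_pair_delta_def Let_def)
\<comment> \<open>The alternatives are the pairs of head movements that occur; \<open>fail\<close>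
  is reached only if \<open>auto\<close> leaves a goal, and then the next pair is tried.\<close>
qed (rule row_pair_step[where d = Right and e = Right] row_pair_step[where d = Right and e = Stay]
    row_pair_step[where d = Left and e = Left] row_pair_step[where d = Left and e = Stay]
    row_pair_step[where d = Stay and e = Right] row_pair_step[where d = Stay and e = Left]
    row_pair_step[where d = Stay and e = Stay]; auto simp: row_pair_delta_def; fail)+

text \<open>Only cell values matter, so the input word is replaced by \<open>f\<close>, which both
  tapes carry after the copying.\<close>

locale matrix_tape =
  fixes n :: nat and A :: "nat \<Rightarrow> nat \<Rightarrow> bool" and f :: "int \<Rightarrow> nat"
  assumes n: "0 < n"
    and entry: "\<And>i k. i < n \<Longrightarrow> k < n \<Longrightarrow> f (int (i * (n + 1) + k)) = (if A i k then 2 else 1)"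
    and row_end: "\<And>i. i < n \<Longrightarrow> f (int (i * (n + 1) + n)) = 3"
    and outside: "\<And>z. z < 0 \<or> int (n * (n + 1)) \<le> z \<Longrightarrow> f z = 0"
begin

text \<open>Column \<open>n\<close> holds the end mark and column \<open>Suc n\<close> is the start
  of the next row, so a head leaving the mark to the right is in place; \<open>pos n 0\<close> is
  the first blank after the matrix.\<close>

definition pos :: "nat \<Rightarrow> nat \<Rightarrow> int" where
  "pos i k = int (i * (n + 1) + k)"

lemma pos_simps [simp]:
  "pos i k + 1 = pos i (Suc k)" "pos i (Suc k) - 1 = pos i k" "pos i (Suc n) = pos (Suc i) 0"
  by (simp_all add: pos_def algebra_simps)

lemma f_pos [simp]:
  "i < n \<Longrightarrow> k < n \<Longrightarrow> f (pos i k) = (if A i k then 2 else 1)"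
  "i < n \<Longrightarrow> f (pos i n) = 3"
  "f (pos n k) = 0"
  using entry row_end outside[of "pos n k"] by (simp_all add: pos_def)

text \<open>Either symbol stops the leftward walk of the first head in state 7.\<close>

lemma f_before_row: "i < n \<Longrightarrow> f (pos i 0 - 1) = 0 \<or> f (pos i 0 - 1) = 3"
proof (cases i)
  case 0
  then show ?thesis using outside[of "-1"] by (simp add: pos_def)
next
  case (Suc i')
  assume "i < n"
  have "pos i 0 - 1 = pos i' n" using Suc by (simp add: pos_def)
  then show ?thesis using Suc \<open>i < n\<close> by simp
qed

lemma f_nonzero:
  assumes "0 \<le> z" "z < int (n * (n + 1))"
  shows "f z \<noteq> 0"
proof -
  define i k where "i = nat z div (n + 1)" and "k = nat z mod (n + 1)"
  have z: "z = pos i k" using assms by (simp only: pos_def i_def k_def div_mult_mod_eq nat_0_le)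
  have "nat z < n * (n + 1)" using assms by linarith
  then have i: "i < n" unfolding i_def by (rule less_mult_imp_div_less)
  have "k < n + 1" by (simp add: k_def)
  then have "k < n \<or> k = n" by linarith
  then show ?thesis using i by (auto simp: z)
qed

text \<open>\<open>m\<close> counts the cells from 0 to \<open>z\<close>, all nonblank, so the head
  stops on the blank cell \<open>-1\<close>.\<close>

lemma rewind_second:
  assumes "z < int (n * (n + 1))" "z = int m - 1"
  shows "\<R> m (conf 10 f h f z) (conf 10 f h f (-1))"
proof -
  have "\<R> (m * 1) (conf 10 f h f (z - int 0)) (conf 10 f h f (z - int m))"
  proof (rule reaches_iterate[where c = "\<lambda>i. conf 10 f h f (z - int i)"])
    fix i assume "i < m"
    then have "f (z - int i) \<noteq> 0" using assms by (intro f_nonzero) auto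
    then show "\<R> 1 (conf 10 f h f (z - int i)) (conf 10 f h f (z - int (Suc i)))"
      using row_pair_steps(22)[of f "z - int i" f h] by (simp add: algebra_simps)
  qed
  then show ?thesis using assms by simp
qed

lemma rewind_both:
  assumes "z < int (n * (n + 1))" "z = int m - 1"
  shows "\<R> m (conf 3 f z f z) (conf 3 f (-1) f (-1))"
proof -
  have "\<R> (m * 1) (conf 3 f (z - int 0) f (z - int 0)) (conf 3 f (z - int m) f (z - int m))"
  proof (rule reaches_iterate[where c = "\<lambda>i. conf 3 f (z - int i) f (z - int i)"])
    fix i assume "i < m"
    then have "f (z - int i) \<noteq> 0" using assms by (intro f_nonzero) auto
    then show "\<R> 1 (conf 3 f (z - int i) f (z - int i))
        (conf 3 f (z - int (Suc i)) f (z - int (Suc i)))"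
      using row_pair_steps(6)[of f "z - int i" f "z - int i"] by (simp add: algebra_simps)
  qed
  then show ?thesis using assms by simp
qed

lemma compare_prefix:
  assumes ij: "i < n" "j < n" and m: "m \<le> n" "\<And>k. k < m \<Longrightarrow> A i k \<or> A j k"
  shows "\<R> m (conf 4 f (pos i 0) f (pos j 0)) (conf 4 f (pos i m) f (pos j m))"
proof -
  have "\<R> (m * 1) (conf 4 f (pos i 0) f (pos j 0)) (conf 4 f (pos i m) f (pos j m))"
  proof (rule reaches_iterate[where c = "\<lambda>k. conf 4 f (pos i k) f (pos j k)"])
    fix k assume "k < m"
    then have "\<R> 1 (conf 4 f (pos i k) f (pos j k)) (conf 4 f (pos i k + 1) f (pos j k + 1))"
      using ij m(1) m(2)[of k] by (intro row_pair_steps) auto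
    then show "\<R> 1 (conf 4 f (pos i k) f (pos j k)) (conf 4 f (pos i (Suc k)) f (pos j (Suc k)))"
      by simp
  qed
  then show ?thesis by simp
qed

text \<open>In the adjacency matrix of a simple graph, such a pair of rows is a total dominating set
  of two vertices.\<close>

definition covering :: "nat \<Rightarrow> nat \<Rightarrow> bool" where
  "covering i j \<longleftrightarrow> (\<forall>k<n. A i k \<or> A j k)"

lemma compare_covering:
  assumes ij: "i < n" "j < n" and "covering i j"
  shows "\<R> (n + 1) (conf 4 f (pos i 0) f (pos j 0)) (conf 12 f (pos i n) f (pos j n))"
proof -
  have "\<R> n (conf 4 f (pos i 0) f (pos j 0)) (conf 4 f (pos i n) f (pos j n))"
    using assms by (intro compare_prefix) (auto simp: covering_def)
  also have "\<R> 1 (conf 4 f (pos i n) f (pos j n)) (conf 12 f (pos i n) f (pos j n))"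
    using ij by (intro row_pair_steps) simp
  finally show ?thesis .
qed

text \<open>State 4 stops at the first uncovered column \<open>m\<close>; the second head walks on
  from there past the end mark. The time \<open>m + 1 + (n - m) + 1\<close> does not depend on
  \<open>m\<close>.\<close>

lemma compare_not_covering:
  assumes ij: "i < n" "j < n" and "\<not> covering i j"
  obtains m where "m < n"
    "\<R> (n + 2) (conf 4 f (pos i 0) f (pos j 0)) (conf 6 f (pos i m) f (pos (Suc j) 0))"
proof -
  define m where "m = (LEAST k. k < n \<and> \<not> (A i k \<or> A j k))"
  have "\<exists>k. k < n \<and> \<not> (A i k \<or> A j k)" using assms by (auto simp: covering_def)
  then have m: "m < n" "\<not> A i m" "\<not> A j m" 
    using LeastI_ex[of "\<lambda>k. k < n \<and> \<not> (A i k \<or> A j k)"] unfolding m_def by blast+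
  have before: "A i k \<or> A j k" if "k < m" for k
    using not_less_Least[OF that[unfolded m_def]] that m(1) by auto
  have "\<R> m (conf 4 f (pos i 0) f (pos j 0)) (conf 4 f (pos i m) f (pos j m))"
    using ij m before by (intro compare_prefix) auto
  also have "\<R> 1 \<dots> (conf 5 f (pos i m) f (pos j m))"
    using ij m by (intro row_pair_steps) auto
  also have "\<R> (n - m) \<dots> (conf 5 f (pos i m) f (pos j n))"
  proof -
    have "\<R> ((n - m) * 1) (conf 5 f (pos i m) f (pos j (m + 0)))
        (conf 5 f (pos i m) f (pos j (m + (n - m))))"
    proof (rule reaches_iterate[where c = "\<lambda>l. conf 5 f (pos i m) f (pos j (m + l))"])
      fix l assume "l < n - m"
      then have "\<R> 1 (conf 5 f (pos i m) f (pos j (m + l)))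
          (conf 5 f (pos i m) f (pos j (m + l) + 1))"
        using ij by (intro row_pair_steps) auto
      then show "\<R> 1 (conf 5 f (pos i m) f (pos j (m + l)))
          (conf 5 f (pos i m) f (pos j (m + Suc l)))"
        by simp
    qed
    then show ?thesis using m(1) by simp
  qed
  also have "\<R> 1 \<dots> (conf 6 f (pos i m) f (pos j n + 1))"
    using ij by (intro row_pair_steps) auto
  finally have "\<R> (n + 2) (conf 4 f (pos i 0) f (pos j 0)) (conf 6 f (pos i m) f (pos (Suc j) 0))"
    using m by simp
  with m(1) show ?thesis by (rule that)
qed

text \<open>The first head overshoots the start of its row by one cell and steps back, in
  \<open>m + 3 \<le> n + 2\<close> steps altogether.\<close>

lemma next_column:
  assumes ij: "i < n" "Suc j < n" and m: "m < n"
  shows "\<R> (n + 2) (conf 6 f (pos i m) f (pos (Suc j) 0)) (conf 4 f (pos i 0) f (pos (Suc j) 0))"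
proof -
  have "\<R> 1 (conf 6 f (pos i m) f (pos (Suc j) 0)) (conf 7 f (pos i m) f (pos (Suc j) 0))"
    using ij n by (intro row_pair_steps) auto
  also have "\<R> (Suc m) \<dots> (conf 7 f (pos i 0 - 1) f (pos (Suc j) 0))"
  proof -
    have "\<R> (Suc m * 1) (conf 7 f (pos i m - int 0) f (pos (Suc j) 0))
        (conf 7 f (pos i m - int (Suc m)) f (pos (Suc j) 0))"
    proof (rule reaches_iterate[where c = "\<lambda>l. conf 7 f (pos i m - int l) f (pos (Suc j) 0)"])
      fix l assume "l < Suc m"
      then have "pos i m - int l = pos i (m - l)" by (simp add: pos_def)
      then have "\<R> 1 (conf 7 f (pos i m - int l) f (pos (Suc j) 0))
          (conf 7 f (pos i m - int l - 1) f (pos (Suc j) 0))"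
        using ij m by (intro row_pair_steps) auto
      then show "\<R> 1 (conf 7 f (pos i m - int l) f (pos (Suc j) 0))
          (conf 7 f (pos i m - int (Suc l)) f (pos (Suc j) 0))"
        by (simp add: algebra_simps)
    qed
    then show ?thesis by (simp add: pos_def)
  qed
  also have "\<R> 1 \<dots> (conf 4 f (pos i 0 - 1 + 1) f (pos (Suc j) 0))"
    using f_before_row[OF ij(1)] by (intro row_pair_steps) auto
  finally have "\<R> (1 + Suc m + 1) (conf 6 f (pos i m) f (pos (Suc j) 0))
      (conf 4 f (pos i 0) f (pos (Suc j) 0))"
    by simp
  then show ?thesis by (rule reaches_mono) (use m in simp)
qed

text \<open>The second head has left the matrix and steps back onto the last end mark, so that
  rewinding in state 10 starts on a nonblank cell.\<close>

lemma next_row: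
  assumes i: "i < n" and m: "m < n"
  shows "\<R> (n + 2) (conf 6 f (pos i m) f (pos n 0)) (conf 9 f (pos (Suc i) 0) f (pos n 0 - 1))"
proof -
  have "\<R> 1 (conf 6 f (pos i m) f (pos n 0)) (conf 8 f (pos i m) f (pos n 0 - 1))"
    by (intro row_pair_steps) simp
  also have "\<R> (n - m) \<dots> (conf 8 f (pos i n) f (pos n 0 - 1))"
  proof -
    have "\<R> ((n - m) * 1) (conf 8 f (pos i (m + 0)) f (pos n 0 - 1))
        (conf 8 f (pos i (m + (n - m))) f (pos n 0 - 1))"
    proof (rule reaches_iterate[where c = "\<lambda>l. conf 8 f (pos i (m + l)) f (pos n 0 - 1)"])
      fix l assume "l < n - m"
      then have "\<R> 1 (conf 8 f (pos i (m + l)) f (pos n 0 - 1))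
          (conf 8 f (pos i (m + l) + 1) f (pos n 0 - 1))"
        using i by (intro row_pair_steps) auto
      then show "\<R> 1 (conf 8 f (pos i (m + l)) f (pos n 0 - 1))
          (conf 8 f (pos i (m + Suc l)) f (pos n 0 - 1))"
        by simp
    qed
    then show ?thesis using m by simp
  qed
  also have "\<R> 1 \<dots> (conf 9 f (pos i n + 1) f (pos n 0 - 1))"
    using i by (intro row_pair_steps) simp
  finally have "\<R> (1 + (n - m) + 1) (conf 6 f (pos i m) f (pos n 0))
      (conf 9 f (pos (Suc i) 0) f (pos n 0 - 1))"
    by simp
  then show ?thesis by (rule reaches_mono) (use m in simp)
qed

text \<open>Numbering the pair \<open>(i, j)\<close> as \<open>i * n + j\<close> turns the two
  nested loops into one over \<open>p < n * n\<close>.\<close>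

definition pair_conf :: "nat \<Rightarrow> config" where
  "pair_conf p = conf 4 f (pos (p div n) 0) f (pos (p mod n) 0)"

text \<open>The cost of the most expensive round, the change to a new row: twice
  \<open>n + 2\<close>, a full rewind of \<open>n * (n + 1)\<close> cells, and two single
  steps.\<close>

definition pair_time :: nat where
  "pair_time = n * (n + 1) + 2 * n + 6"

lemma next_pair:
  assumes p: "Suc p < n * n" and nc: "\<not> covering (p div n) (p mod n)"
  shows "\<R> pair_time (pair_conf p) (pair_conf (Suc p))"
proof -
  define i j where "i = p div n" and "j = p mod n"
  have ij: "i < n" "j < n"
    using p n by (auto simp: i_def j_def less_mult_imp_div_less)
  obtain m where m: "m < n"
    "\<R> (n + 2) (conf 4 f (pos i 0) f (pos j 0)) (conf 6 f (pos i m) f (pos (Suc j) 0))"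
    using compare_not_covering[OF ij] nc by (auto simp: i_def j_def)
  show ?thesis
  proof (cases "Suc j < n")
    case True
    then have "Suc p div n = i" "Suc p mod n = Suc j"
      by (auto simp: i_def j_def div_Suc mod_Suc)
    then have "\<R> ((n + 2) + (n + 2)) (pair_conf p) (pair_conf (Suc p))"
      using reaches_trans[OF m(2) next_column[OF ij(1) True m(1)]]
      by (simp add: pair_conf_def flip: i_def j_def)
    then show ?thesis by (rule reaches_mono) (simp add: pair_time_def)
  next
    case False
    then have j: "Suc j = n" using ij by simp
    then have sp: "Suc p div n = Suc i" "Suc p mod n = 0"
      by (auto simp: i_def j_def div_Suc mod_Suc)
    have i: "Suc i < n" using p less_mult_imp_div_less[of "Suc p" n n] sp by simp
    have "\<R> (n + 2) (pair_conf p) (conf 6 f (pos i m) f (pos n 0))"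
      using m(2) by (simp add: pair_conf_def j flip: i_def j_def)
    also have "\<R> (n + 2) \<dots> (conf 9 f (pos (Suc i) 0) f (pos n 0 - 1))"
      using ij(1) m(1) by (rule next_row)
    also have "\<R> 1 \<dots> (conf 10 f (pos (Suc i) 0) f (pos n 0 - 1))"
      using i n by (intro row_pair_steps) auto
    also have "\<R> (n * (n + 1)) \<dots> (conf 10 f (pos (Suc i) 0) f (-1))"
      by (intro rewind_second) (auto simp: pos_def)
    also have "\<R> 1 \<dots> (conf 4 f (pos (Suc i) 0) f (-1 + 1))"
      using outside[of "-1"] by (intro row_pair_steps) simp
    also have "\<dots> = pair_conf (Suc p)" by (simp add: pair_conf_def sp pos_def)
    finally have "\<R> (n + 2 + (n + 2) + 1 + n * (n + 1) + 1) (pair_conf p) (pair_conf (Suc p))" .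
    then show ?thesis by (rule reaches_mono) (simp add: pair_time_def)
  qed
qed

lemma last_pair:
  assumes "\<not> covering (n - 1) (n - 1)"
  shows "\<exists>h k. \<R> pair_time (pair_conf (n * n - 1)) (conf 11 f h f k)"
proof -
  have "n * n - 1 = (n - 1) * n + (n - 1)" using n by (cases n) auto
  then have p: "(n * n - 1) div n = n - 1" "(n * n - 1) mod n = n - 1"
    using n by (simp_all only: div_mult_self3 mod_mult_self3) simp_all
  obtain m where m: "m < n"
    "\<R> (n + 2) (conf 4 f (pos (n - 1) 0) f (pos (n - 1) 0)) (conf 6 f (pos (n - 1) m) f (pos (Suc (n - 1)) 0))"
    using compare_not_covering[of "n - 1" "n - 1"] n assms by auto
  have S: "Suc (n - 1) = n" using n by simp
  have "\<R> ((n + 2) + (n + 2)) (pair_conf (n * n - 1)) (conf 9 f (pos n 0) f (pos n 0 - 1))"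
    using reaches_trans[OF m(2)[unfolded S] next_row[of "n - 1" m]] n m(1)
    by (simp add: pair_conf_def S p[simplified])
  also have "\<R> 1 \<dots> (conf 11 f (pos n 0) f (pos n 0 - 1))"
    by (intro row_pair_steps) simp
  finally have "\<R> pair_time (pair_conf (n * n - 1)) (conf 11 f (pos n 0) f (pos n 0 - 1))"
    by (rule reaches_mono) (simp add: pair_time_def)
  then show ?thesis by blast
qed

text \<open>The run passes noncovering pairs up to the least covering one and rejects there, or
  passes all of them and accepts; each pair costs at most \<open>pair_time\<close>.\<close>

lemma main_loop:
  "\<exists>h k. \<R> (n * n * pair_time) (conf 4 f 0 f 0)
    (conf (if \<exists>i<n. \<exists>j<n. covering i j then 12 else 11) f h f k)"
proof -
  have start: "conf 4 f 0 f 0 = pair_conf 0" by (simp add: pair_conf_def pos_def)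
  have run: "\<R> (p * pair_time) (pair_conf 0) (pair_conf p)"
    if "p < n * n" "\<And>r. r < p \<Longrightarrow> \<not> covering (r div n) (r mod n)" for p
    using that by (intro reaches_iterate next_pair) auto
  have fin: "\<R> (n * n * pair_time) (pair_conf 0) c"
    if "p < n * n" "\<R> (p * pair_time) (pair_conf 0) (pair_conf p)" "\<R> pair_time (pair_conf p) c" for p c
  proof -
    have "\<R> (p * pair_time + pair_time) (pair_conf 0) c" using that(2,3) by (rule reaches_trans)
    moreover have "Suc p * pair_time \<le> n * n * pair_time" using that(1) by (intro mult_le_mono1) simp
    ultimately show ?thesis by (auto elim: reaches_mono)
  qed
  show ?thesis
  proof (cases "\<exists>i<n. \<exists>j<n. covering i j")
    case True
    then obtain i j where ij: "i < n" "j < n" "covering i j" by blast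
    define P where "P p \<longleftrightarrow> p < n * n \<and> covering (p div n) (p mod n)" for p
    have "i * n + j < (i + 1) * n" using ij by simp
    also have "\<dots> \<le> n * n" using ij by (intro mult_le_mono1) simp
    finally have "P (i * n + j)" using ij by (simp add: P_def div_mult_self3)
    define p where "p = (LEAST p. P p)"
    have p: "P p" unfolding p_def using \<open>P (i * n + j)\<close> by (rule LeastI)
    have before: "\<not> covering (r div n) (r mod n)" if "r < p" for r
      using not_less_Least[OF that[unfolded p_def]] that p by (auto simp: P_def)
    have "\<R> (n + 1) (pair_conf p) (conf 12 f (pos (p div n) n) f (pos (p mod n) n))"
      using p n unfolding pair_conf_def P_def
      by (intro compare_covering) (auto simp: less_mult_imp_div_less)
    then have "\<R> pair_time (pair_conf p) (conf 12 f (pos (p div n) n) f (pos (p mod n) n))"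
      by (rule reaches_mono) (simp add: pair_time_def)
    then have "\<R> (n * n * pair_time) (pair_conf 0)
        (conf 12 f (pos (p div n) n) f (pos (p mod n) n))"
      using p before by (intro fin[OF _ run]) (auto simp: P_def)
    then show ?thesis using True unfolding start by auto
  next
    case False
    then have nc: "\<not> covering (r div n) (r mod n)" if "r < n * n" for r
      using that n by (auto simp: less_mult_imp_div_less)
    obtain h k where "\<R> pair_time (pair_conf (n * n - 1)) (conf 11 f h f k)"
      using last_pair False n by fastforce
    then have "\<R> (n * n * pair_time) (pair_conf 0) (conf 11 f h f k)"
      using n nc by (intro fin[OF _ run]) auto
    then show ?thesis using False unfolding start by auto
  qed
qed

lemma copy_input:
  "\<R> (2 * (n * (n + 1)) + 2) (conf 2 f 0 (\<lambda>_. 0) 0) (conf 4 f 0 f 0)"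
proof -
  define N where "N = n * (n + 1)"
  \<comment> \<open>The second tape after \<open>m\<close> steps: the cells below \<open>m\<close>
    are copied, the negative ones being blank in \<open>f\<close> anyway.\<close>
  define g where "g m z = (if z < int m then f z else 0)" for m z
  have g: "g 0 = (\<lambda>_. 0)" "g N = f" "(g m)(int m := f (int m)) = g (Suc m)" for m
    using outside by (auto simp: g_def N_def fun_eq_iff)
  have "\<R> (N * 1) (conf 2 f (int 0) (g 0) (int 0)) (conf 2 f (int N) (g N) (int N))"
  proof (rule reaches_iterate[where c = "\<lambda>m. conf 2 f (int m) (g m) (int m)"])
    fix m assume "m < N"
    then have "f (int m) \<noteq> 0"
      by (intro f_nonzero) (simp_all add: N_def del: of_nat_mult of_nat_add)
    then show "\<R> 1 (conf 2 f (int m) (g m) (int m)) (conf 2 f (int (Suc m)) (g (Suc m)) (int (Suc m)))"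
      using row_pair_steps(4)[of f "int m" "g m" "int m"] by (simp add: g add.commute)
  qed
  then have "\<R> N (conf 2 f 0 (\<lambda>_. 0) 0) (conf 2 f (int N) f (int N))"
    by (simp add: g)
  also have "\<R> 1 \<dots> (conf 3 f (int N - 1) f (int N - 1))"
    using outside[of "int N"] by (intro row_pair_steps) (simp_all add: N_def)
  also have "\<R> N \<dots> (conf 3 f (-1) f (-1))"
    by (intro rewind_both) (simp_all add: N_def)
  also have "\<R> 1 \<dots> (conf 4 f (-1 + 1) f (-1 + 1))"
    using outside[of "-1"] by (intro row_pair_steps) simp
  finally have "\<R> (N + 1 + N + 1) (conf 2 f 0 (\<lambda>_. 0) 0) (conf 4 f 0 f 0)"
    by simp
  then show ?thesis by (rule reaches_mono) (simp add: N_def)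
qed

text \<open>Cell 1 holds the end mark iff \<open>n = 1\<close>. This case is caught early because
  the matrix of the one-vertex graph has no covering pair, so that the loop would accept it.\<close>

lemma row_pair_machine_run:
  "\<exists>h g k. \<R> (2 * (n * (n + 1)) + 4 + n * n * pair_time) (conf 0 f 0 (\<lambda>_. 0) 0)
    (conf (if n = 1 \<or> (\<exists>i<n. \<exists>j<n. covering i j) then 12 else 11) f h g k)"
proof -
  have s0: "\<R> 1 (conf 0 f 0 (\<lambda>_. 0) 0) (conf 1 f 1 (\<lambda>_. 0) 0)"
    using row_pair_steps(1)[of f 0] by simp
  show ?thesis
  proof (cases "n = 1")
    case True
    then have "f 1 = 3" using row_end[of 0] by simp
    then have "\<R> 1 (conf 1 f 1 (\<lambda>_. 0) 0) (conf 12 f 1 (\<lambda>_. 0) 0)" by (intro row_pair_steps)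
    then have "\<R> (1 + 1) (conf 0 f 0 (\<lambda>_. 0) 0) (conf 12 f 1 (\<lambda>_. 0) 0)" by (rule reaches_trans[OF s0])
    then have "\<R> (2 * (n * (n + 1)) + 4 + n * n * pair_time) (conf 0 f 0 (\<lambda>_. 0) 0) (conf 12 f 1 (\<lambda>_. 0) 0)"
      by (rule reaches_mono) simp
    then show ?thesis using True by auto
  next
    case False
    then have "f 1 \<noteq> 3" using entry[of 0 1] n by simp
    then have "\<R> 1 (conf 1 f 1 (\<lambda>_. 0) 0) (conf 2 f (1 - 1) (\<lambda>_. 0) 0)" by (intro row_pair_steps)
    then have "\<R> (1 + 1) (conf 0 f 0 (\<lambda>_. 0) 0) (conf 2 f 0 (\<lambda>_. 0) 0)"
      using reaches_trans[OF s0] by simp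
    then have r: "\<R> (1 + 1 + (2 * (n * (n + 1)) + 2)) (conf 0 f 0 (\<lambda>_. 0) 0) (conf 4 f 0 f 0)"
      using copy_input by (rule reaches_trans)
    obtain h k where "\<R> (n * n * pair_time) (conf 4 f 0 f 0)
        (conf (if \<exists>i<n. \<exists>j<n. covering i j then 12 else 11) f h f k)"
      using main_loop by blast
    with r have "\<R> (1 + 1 + (2 * (n * (n + 1)) + 2) + n * n * pair_time) (conf 0 f 0 (\<lambda>_. 0) 0)
        (conf (if \<exists>i<n. \<exists>j<n. covering i j then 12 else 11) f h f k)"
      by (rule reaches_trans)
    then have "\<R> (2 * (n * (n + 1)) + 4 + n * n * pair_time) (conf 0 f 0 (\<lambda>_. 0) 0)
        (conf (if \<exists>i<n. \<exists>j<n. covering i j then 12 else 11) f h f k)"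
      by (rule reaches_mono) simp
    then show ?thesis using False by (simp only: simp_thms) blast
  qed
qed

end

section \<open>From encoded words to tape cells, and the polynomial bound\<close>

lemma nth_concat_equal_length:
  assumes "\<And>xs. xs \<in> set xss \<Longrightarrow> length xs = m" "i < length xss" "k < m"
  shows "concat xss ! (i * m + k) = xss ! i ! k"
  using assms
proof (induction xss arbitrary: i)
  case (Cons xs xss)
  then show ?case by (cases i) (auto simp: nth_append)
qed simp

lemma length_concat_equal_length:
  "(\<And>xs. xs \<in> set xss \<Longrightarrow> length xs = m) \<Longrightarrow> length (concat xss) = length xss * m"
  by (induction xss) auto

definition matrix_word :: "nat \<Rightarrow> (nat \<Rightarrow> nat \<Rightarrow> bool) \<Rightarrow> nat list" where
  "matrix_word n A = concat (map (\<lambda>i. map (\<lambda>j. if A i j then 2 else 1) [0..<n] @ [3]) [0..<n])"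

lemma length_matrix_word: "length (matrix_word n A) = n * (n + 1)"
  unfolding matrix_word_def by (subst length_concat_equal_length[where m = "n + 1"]) auto

lemma nth_matrix_word:
  assumes "i < n" "k < n + 1"
  shows "matrix_word n A ! (i * (n + 1) + k) = (if k = n then 3 else if A i k then 2 else 1)"
  unfolding matrix_word_def using assms
  by (subst nth_concat_equal_length[where m = "n + 1"]) (auto simp: nth_append)

lemma set_matrix_word: "set (matrix_word n A) \<subseteq> {1..<4}"
  by (auto simp: matrix_word_def)

lemma row_pair_machine_correct:
  fixes A :: "nat \<Rightarrow> nat \<Rightarrow> bool"
  assumes n: "0 < n"
  defines "w \<equiv> matrix_word n A"
  defines "t \<equiv> poly [:4, 8, 3:] (length w)"
  shows "if n = 1 \<or> (\<exists>i<n. \<exists>j<n. \<forall>k<n. A i k \<or> A j k)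
    then rejects_within row_pair_machine w t else accepts_within row_pair_machine w t"
proof -
  define f where "f = fst (input_tape w)"
  interpret matrix_tape n A f
  proof
    have le: "i * (n + 1) + k < n * (n + 1)" if "i < n" "k < n + 1" for i k
    proof -
      have "i * (n + 1) + k < (i + 1) * (n + 1)" using that by simp
      also have "\<dots> \<le> n * (n + 1)" using that by (intro mult_le_mono1) simp
      finally show ?thesis .
    qed
    have f: "f (int (i * (n + 1) + k)) = (if k = n then 3 else if A i k then 2 else 1)"
      if "i < n" "k < n + 1" for i k
      using le[OF that] nth_matrix_word[OF that, of A]
      by (simp add: f_def w_def input_tape_def length_matrix_word del: of_nat_add of_nat_mult
          mult_Suc_right add_Suc_right Suc_eq_plus1)
    show "f (int (i * (n + 1) + k)) = (if A i k then 2 else 1)" if "i < n" "k < n" for i k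
      using f[of i k] that by simp
    show "f (int (i * (n + 1) + n)) = 3" if "i < n" for i
      using f[of i n] that by simp
    show "f z = 0" if "z < 0 \<or> int (n * (n + 1)) \<le> z" for z
      using that by (auto simp: f_def w_def input_tape_def length_matrix_word)
  qed fact
  let ?N = "n * (n + 1)" and ?b = "n = 1 \<or> (\<exists>i<n. \<exists>j<n. covering i j)"
  \<comment> \<open>With \<open>N = n * (n + 1)\<close> the loop takes at most
    \<open>N * (3 * N + 6)\<close> steps and the rest \<open>2 * N + 4\<close>, which gives the
    coefficients 4, 8 and 3.\<close>
  have "n * n \<le> ?N" "n \<le> ?N" by auto
  then have "n * n * pair_time \<le> ?N * (?N + 2 * ?N + 6)"
    unfolding pair_time_def by (intro mult_le_mono add_le_mono) auto
  moreover have "t = 4 + ?N * (8 + ?N * 3)"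
    by (simp add: t_def w_def length_matrix_word)
  ultimately have le: "2 * ?N + 4 + n * n * pair_time \<le> t" by (simp add: algebra_simps)
  obtain h g k where "\<R> (2 * ?N + 4 + n * n * pair_time) (conf 0 f 0 (\<lambda>_. 0) 0)
      (conf (if ?b then 12 else 11) f h g k)"
    using row_pair_machine_run by blast
  then have "\<R> t (conf 0 f 0 (\<lambda>_. 0) 0) (conf (if ?b then 12 else 11) f h g k)"
    using le by (rule reaches_mono)
  moreover have "conf 0 f 0 (\<lambda>_. 0) 0 = initial row_pair_machine w"
    by (simp add: initial_def conf_def row_pair_machine_def f_def input_tape_def blank_tape_def)
  ultimately have "(step row_pair_machine ^^ t) (initial row_pair_machine w) = conf (if ?b then 12 else 11) f h g k"
    unfolding conf_def by (intro reaches_halted) (simp_all add: row_pair_machine_def)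
  then show ?thesis
    by (simp add: accepts_within_def rejects_within_def conf_def row_pair_machine_def covering_def)
qed

theorem theorem8:
  "polynomial_time_solvable_on encode_graph
     {G \<in> input_graphs. induced_free (path_graph 5) G}
     one_edge_contraction"
  unfolding polynomial_time_solvable_on_def
proof (intro exI conjI ballI)
  show "tm row_pair_machine" by (rule tm_row_pair_machine)
next
  fix G :: "nat graph" assume "G \<in> {G \<in> input_graphs. induced_free (path_graph 5) G}"
  then have G: "simple_graph G" "connected_graph G" "induced_free (path_graph 5) G"
    and V: "verts G = {..<card (verts G)}"
    by (auto simp: input_graphs_def)
  define n where "n = card (verts G)"
  have enc: "encode_graph G = matrix_word n (adj G)"
    by (simp add: encode_graph_def matrix_word_def n_def adj_def Let_def)
  have n: "0 < n" using G(1,2) by (auto simp: n_def card_gt_0_iff simple_graph_def connected_graph_def)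
  \<comment> \<open>The vertices are the row numbers, so the criterion for the answer no is the
    rejection condition of the machine.\<close>
  have *: "one_edge_contraction G \<longleftrightarrow>
      \<not> (n = 1 \<or> (\<exists>i<n. \<exists>j<n. \<forall>k<n. adj G i k \<or> adj G j k))"
    using one_edge_contraction_P5_free[OF G] V by (simp add: Bex_def Ball_def flip: n_def)
  show "set (encode_graph G) \<subseteq> {1..<symbols row_pair_machine}"
    using set_matrix_word by (simp add: enc row_pair_machine_def)
  show "if one_edge_contraction G
    then accepts_within row_pair_machine (encode_graph G) (poly [:4, 8, 3:] (length (encode_graph G)))
    else rejects_within row_pair_machine (encode_graph G) (poly [:4, 8, 3:] (length (encode_graph G)))"
    using row_pair_machine_correct[OF n, of "adj G"] unfolding * enc if_bool_eq_conj by blast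
qed

end
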